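(* Let $q>2$ be the fixed constant used in the PP limiter (it can be arbitrarily specified in $(2,+\infty)$). If $\overline{\bm Q}_{ij}^n\in\mathcal G$ for all $i$ and $j$, then the updated cell averages $$\overline{\bm Q}_{ij}^{n+1}=\overline{\bm Q}_{ij}^{n}-\frac{\Delta t}{\Delta x}\left(\hat{\bm G}_1\left(\widetilde{\bm Q}^{n,-}_{i+\frac12,j},\widetilde{\bm Q}^{n,+}_{i+\frac12,j}\right)-\hat{\bm G}_1\left(\widetilde{\bm Q}^{n,-}_{i-\frac12,j},\widetilde{\bm Q}^{n,+}_{i-\frac12,j}\right)\right)-\frac{\Delta t}{\Delta y}\left(\hat{\bm G}_2\left(\widetilde{\bm Q}^{n,-}_{i,j+\frac12},\widetilde{\bm Q}^{n,+}_{i,j+\frac12}\right)-\hat{\bm G}_2\left(\widetilde{\bm Q}^{n,-}_{i,j-\frac12},\widetilde{\bm Q}^{n,+}_{i,j-\frac12}\right)\right)$$ always belong to $\mathcal G$ under the CFL condition $$\Delta t\left(\frac{\alpha_1}{\Delta x}+\frac{\alpha_2}{\Delta y}\right)\le\frac1q .$$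
   Context: Constants: $\gamma>1$, mesh sizes $\Delta x,\Delta y>0$, time step $\Delta t>0$, a small $\epsilon>0$ (e.g. $10^{-14}$). Indices $i,j$ range over all cells (including any cells needed by the stencil) of a uniform rectangular mesh. States and admissible set: $\bm Q=(\rho,\bm m,E)^\top$ with $\rho,E\in\mathbb R$, $\bm m\in\mathbb R^3$, $\mathcal G=\{\bm Q:\rho>0,\ E-\frac{|\bm m|^2}{2\rho}>0\}$. Primitive variables $\bm W=(\rho,\bm v,p)^\top$: $\bm v=\bm m/\rho$, $p=(\gamma-1)\left(E-\frac{|\bm m|^2}{2\rho}\right)$; conversely $\bm m=\rho\bm v$, $E=\frac{p}{\gamma-1}+\frac12\rho|\bm v|^2$. Sound speed $c=\sqrt{\gamma p/\rho}$. Fluxes: $\bm G_\ell(\bm Q)=(m_\ell,\ m_\ell\bm v+p\,\mathbf e_\ell,\ (E+p)v_\ell)^\top$, and the Lax--Friedrichs flux $\hat{\bm G}_\ell(\bm Q^-,\bm Q^+)=\frac12\left(\bm G_\ell(\bm Q^-)+\bm G_\ell(\bm Q^+)-\alpha_\ell(\bm Q^+-\bm Q^-)\right)$, $\ell=1,2$, where $\alpha_\ell=\|\,|v_\ell|+c\,\|_{L^\infty}$; in particular $\alpha_\ell\ge|v_\ell|+c$ at every interface state $\widetilde{\bm Q}$ entering the scheme. Reconstruction: $\overline{\bm W}_{ij}^n=(\overline\rho_{ij}^n,\overline{\bm v}_{ij}^n,\overline p_{ij}^n)^\top$ are the primitive variables of $\overline{\bm Q}_{ij}^n$. Slopes are computed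 componentwise by the van Albada limiter: for a scalar component $W$ with $a=(\overline W_{ij}^n-\overline W_{i-1,j}^n)/\Delta x$, $b=(\overline W_{i+1,j}^n-\overline W_{ij}^n)/\Delta x$, $\epsilon_x=3\Delta x$, set $\delta W_{ij}^x=\frac{(b^2+\epsilon_x)a+(a^2+\epsilon_x)b}{a^2+b^2+2\epsilon_x}$; $\delta W_{ij}^y$ is defined analogously in $y$ with $\epsilon_y=3\Delta y$. Put $(\Delta\rho_{ij}^x,\Delta\bm v_{ij}^x,\Delta p_{ij}^x)^\top=\frac{\Delta x}{2}\delta\bm W_{ij}^x$, $(\Delta\rho_{ij}^y,\Delta\bm v_{ij}^y,\Delta p_{ij}^y)^\top=\frac{\Delta y}{2}\delta\bm W_{ij}^y$. PP limiter with parameter $q>2$ (applied in each cell): put $C_x=\frac{\alpha_1\Delta y}{\alpha_1\Delta y+\alpha_2\Delta x}$, $C_y=\frac{\alpha_2\Delta x}{\alpha_1\Delta y+\alpha_2\Delta x}$. For $\star\in\{x,y\}$: $\alpha^\star=\min\left(\frac{\overline\rho_{ij}^n}{|\Delta\rho_{ij}^\star|(1+\epsilon)},1\right)$ if $\Delta\rho_{ij}^\star\ne0$, else $1$; $\kappa^\star=\min\left(\frac{\overline p_{ij}^n}{|\Delta p_{ij}^\star|(1+\epsilon)},1\right)$ if $\Delta p_{ij}^\star\neq0$, else $1$. If $|\Delta\bm v_{ij}^x|+|\Delta\bm v_{ij}^y|\ne0$, $$\beta=\min\left(\sqrt{\frac{(q-2)^2\,\overline\rho_{ij}^n\,\overline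 p_{ij}^n}{(\gamma-1)\left(2\left|C_x\alpha^x\Delta\rho_{ij}^x\Delta\bm v_{ij}^x+C_y\alpha^y\Delta\rho_{ij}^y\Delta\bm v_{ij}^y\right|^2+(q-2)(\overline\rho_{ij}^n)^2\left(C_x|\Delta\bm v_{ij}^x|^2+C_y|\Delta\bm v_{ij}^y|^2\right)\right)}},\,1\right),$$ else $\beta=1$. The modified primitive limiting values are $\widetilde{\bm W}^{n,\mp}_{i\pm\frac12,j}=(\overline\rho_{ij}^n\pm\alpha^x\Delta\rho_{ij}^x,\ \overline{\bm v}_{ij}^n\pm\beta\Delta\bm v_{ij}^x,\ \overline p_{ij}^n\pm\kappa^x\Delta p_{ij}^x)^\top$ and $\widetilde{\bm W}^{n,\mp}_{i,j\pm\frac12}=(\overline\rho_{ij}^n\pm\alpha^y\Delta\rho_{ij}^y,\ \overline{\bm v}_{ij}^n\pm\beta\Delta\bm v_{ij}^y,\ \overline p_{ij}^n\pm\kappa^y\Delta p_{ij}^y)^\top$; $\widetilde{\bm Q}$ (same indices) is the conservative state with primitive variables $\widetilde{\bm W}$. *)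

theory Defs
  imports "HOL-Analysis.Analysis"
begin

text \<open>
  A triple stands either for conservative variables (rho, m, E) or for primitive
  variables (rho, v, p).  Only the vector space structure of the product type is used,
  never its norm; norms of vectors in \<^typ>\<open>real^3\<close> are Euclidean.
\<close>

type_synonym state = "real \<times> (real^3) \<times> real"

definition admissible :: "state set" where
  "admissible = {(\<rho>, m, E) | \<rho> m E. \<rho> > 0 \<and> E - (norm m)\<^sup>2 / (2 * \<rho>) > 0}"

definition prim :: "real \<Rightarrow> state \<Rightarrow> state" where
  "prim \<gamma> = (\<lambda>(\<rho>, m, E). (\<rho>, m /\<^sub>R \<rho>, (\<gamma> - 1) * (E - (norm m)\<^sup>2 / (2 * \<rho>))))"

definition cons :: "real \<Rightarrow> state \<Rightarrow> state" where
  "cons \<gamma> = (\<lambda>(\<rho>, v, p). (\<rho>, \<rho> *\<^sub>R v, p / (\<gamma> - 1) + 1 / 2 * \<rho> * (norm v)\<^sup>2))"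

text \<open>The index \<open>l :: 3\<close> is the space direction; the scheme uses only 1 and 2.\<close>

definition wave_speed :: "real \<Rightarrow> 3 \<Rightarrow> state \<Rightarrow> real" where
  "wave_speed \<gamma> l Q = (case prim \<gamma> Q of (\<rho>, v, p) \<Rightarrow> \<bar>v $ l\<bar> + sqrt (\<gamma> * p / \<rho>))"

definition flux :: "real \<Rightarrow> 3 \<Rightarrow> state \<Rightarrow> state" where
  "flux \<gamma> l Q =
    (case Q of (_, m, E) \<Rightarrow> case prim \<gamma> Q of (_, v, p) \<Rightarrow>
      (m $ l, (m $ l) *\<^sub>R v + p *\<^sub>R axis l 1, (E + p) * v $ l))"

definition lf_flux :: "real \<Rightarrow> 3 \<Rightarrow> real \<Rightarrow> state \<Rightarrow> state \<Rightarrow> state" where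
  "lf_flux \<gamma> l \<alpha> Qm Qp =
    (1 / 2) *\<^sub>R (flux \<gamma> l Qm + flux \<gamma> l Qp - \<alpha> *\<^sub>R (Qp - Qm))"

text \<open>
  \<open>speed1\<close> and \<open>speed2\<close> are the viscosity coefficients of the Lax--Friedrichs fluxes in the
  two directions.  They enter the limiter below and are therefore parameters of the
  reconstruction, \<open>eps\<close> is the small number in the limiter and \<open>qlim\<close> its constant q.
\<close>

record scheme =
  gam :: real
  dx :: real
  dy :: real
  dt :: real
  eps :: real
  qlim :: real
  speed1 :: real
  speed2 :: real

definition van_albada :: "real \<Rightarrow> real \<Rightarrow> real \<Rightarrow> real" where
  "van_albada e a b = ((b\<^sup>2 + e) * a + (a\<^sup>2 + e) * b) / (a\<^sup>2 + b\<^sup>2 + 2 * e)"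

definition van_albada_state :: "real \<Rightarrow> state \<Rightarrow> state \<Rightarrow> state" where
  "van_albada_state e = (\<lambda>(\<rho>a, va, pa) (\<rho>b, vb, pb).
    (van_albada e \<rho>a \<rho>b, (\<chi> k. van_albada e (va $ k) (vb $ k)), van_albada e pa pb))"

text \<open>
  A grid function \<open>Q :: int \<Rightarrow> int \<Rightarrow> state\<close> holds the conservative cell averages.
  \<open>incr_x\<close> and \<open>incr_y\<close> are the limited slopes of the primitive variables multiplied by half
  the mesh size.
\<close>

definition incr_x :: "scheme \<Rightarrow> (int \<Rightarrow> int \<Rightarrow> state) \<Rightarrow> int \<Rightarrow> int \<Rightarrow> state" where
  "incr_x S Q i j = (let W = (\<lambda>k l. prim (gam S) (Q k l)) in
    (dx S / 2) *\<^sub>R van_albada_state (3 * dx S)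
      ((W i j - W (i - 1) j) /\<^sub>R dx S) ((W (i + 1) j - W i j) /\<^sub>R dx S))"

definition incr_y :: "scheme \<Rightarrow> (int \<Rightarrow> int \<Rightarrow> state) \<Rightarrow> int \<Rightarrow> int \<Rightarrow> state" where
  "incr_y S Q i j = (let W = (\<lambda>k l. prim (gam S) (Q k l)) in
    (dy S / 2) *\<^sub>R van_albada_state (3 * dy S)
      ((W i j - W i (j - 1)) /\<^sub>R dy S) ((W i (j + 1) - W i j) /\<^sub>R dy S))"

definition weight_x :: "scheme \<Rightarrow> real" where
  "weight_x S = speed1 S * dy S / (speed1 S * dy S + speed2 S * dx S)"

definition weight_y :: "scheme \<Rightarrow> real" where
  "weight_y S = speed2 S * dx S / (speed1 S * dy S + speed2 S * dx S)"

text \<open>Limiting factor of density and pressure: \<open>w\<close> is the cell value, \<open>d\<close> the increment.\<close>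

definition pos_factor :: "real \<Rightarrow> real \<Rightarrow> real \<Rightarrow> real" where
  "pos_factor e w d = (if d \<noteq> 0 then min (w / (\<bar>d\<bar> * (1 + e))) 1 else 1)"

definition velocity_factor :: "scheme \<Rightarrow> state \<Rightarrow> state \<Rightarrow> state \<Rightarrow> real" where
  "velocity_factor S = (\<lambda>(\<rho>, v, p) (\<rho>x, vx, px) (\<rho>y, vy, py).
    (let Cx = weight_x S; Cy = weight_y S; q = qlim S;
         ax = pos_factor (eps S) \<rho> \<rho>x; ay = pos_factor (eps S) \<rho> \<rho>y
     in if norm vx + norm vy \<noteq> 0
        then min (sqrt ((q - 2)\<^sup>2 * \<rho> * p /
               ((gam S - 1) *
                 (2 * (norm ((Cx * ax * \<rho>x) *\<^sub>R vx + (Cy * ay * \<rho>y) *\<^sub>R vy))\<^sup>2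
                  + (q - 2) * \<rho>\<^sup>2 * (Cx * (norm vx)\<^sup>2 + Cy * (norm vy)\<^sup>2))))) 1
        else 1))"

definition limited :: "real \<Rightarrow> real \<Rightarrow> state \<Rightarrow> state \<Rightarrow> state" where
  "limited e \<beta> = (\<lambda>(\<rho>, v, p) (\<rho>d, vd, pd).
    (pos_factor e \<rho> \<rho>d * \<rho>d, \<beta> *\<^sub>R vd, pos_factor e p pd * pd))"

definition limited_x :: "scheme \<Rightarrow> (int \<Rightarrow> int \<Rightarrow> state) \<Rightarrow> int \<Rightarrow> int \<Rightarrow> state" where
  "limited_x S Q i j = (let W = prim (gam S) (Q i j) in
    limited (eps S) (velocity_factor S W (incr_x S Q i j) (incr_y S Q i j)) W (incr_x S Q i j))"

definition limited_y :: "scheme \<Rightarrow> (int \<Rightarrow> int \<Rightarrow> state) \<Rightarrow> int \<Rightarrow> int \<Rightarrow> state" where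
  "limited_y S Q i j = (let W = prim (gam S) (Q i j) in
    limited (eps S) (velocity_factor S W (incr_x S Q i j) (incr_y S Q i j)) W (incr_y S Q i j))"

text \<open>
  Conservative limiting values.  The index \<open>i j\<close> denotes the interface between the cells
  (i, j) and (i + 1, j) for x, and between (i, j) and (i, j + 1) for y; the
  ``minus'' value comes from the cell (i, j), the ``plus'' value from its neighbour.
\<close>

definition x_minus :: "scheme \<Rightarrow> (int \<Rightarrow> int \<Rightarrow> state) \<Rightarrow> int \<Rightarrow> int \<Rightarrow> state" where
  "x_minus S Q i j = cons (gam S) (prim (gam S) (Q i j) + limited_x S Q i j)"

definition x_plus :: "scheme \<Rightarrow> (int \<Rightarrow> int \<Rightarrow> state) \<Rightarrow> int \<Rightarrow> int \<Rightarrow> state" where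
  "x_plus S Q i j = cons (gam S) (prim (gam S) (Q (i + 1) j) - limited_x S Q (i + 1) j)"

definition y_minus :: "scheme \<Rightarrow> (int \<Rightarrow> int \<Rightarrow> state) \<Rightarrow> int \<Rightarrow> int \<Rightarrow> state" where
  "y_minus S Q i j = cons (gam S) (prim (gam S) (Q i j) + limited_y S Q i j)"

definition y_plus :: "scheme \<Rightarrow> (int \<Rightarrow> int \<Rightarrow> state) \<Rightarrow> int \<Rightarrow> int \<Rightarrow> state" where
  "y_plus S Q i j = cons (gam S) (prim (gam S) (Q i (j + 1)) - limited_y S Q i (j + 1))"

text \<open>
  The update of a cell uses the reconstructions in the cell and its four neighbours, and
  each reconstruction uses the four neighbours of its cell (the velocity factor combines the
  slopes of both directions).  A mesh is a set of cells including ghost cells; the scheme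
  updates the cells whose whole stencil lies in the mesh.
\<close>

definition stencil :: "int \<Rightarrow> int \<Rightarrow> (int \<times> int) set" where
  "stencil i j = {(k, l). \<bar>k - i\<bar> + \<bar>l - j\<bar> \<le> 2}"

definition updated_cells :: "(int \<times> int) set \<Rightarrow> (int \<times> int) set" where
  "updated_cells mesh = {(i, j). stencil i j \<subseteq> mesh}"

text \<open>The interface states at which the numerical fluxes are evaluated.\<close>

definition x_states :: "scheme \<Rightarrow> (int \<Rightarrow> int \<Rightarrow> state) \<Rightarrow> (int \<times> int) set \<Rightarrow> state set" where
  "x_states S Q mesh = (\<Union>(i, j)\<in>updated_cells mesh.
    {x_minus S Q i j, x_plus S Q i j, x_minus S Q (i - 1) j, x_plus S Q (i - 1) j})"

definition y_states :: "scheme \<Rightarrow> (int \<Rightarrow> int \<Rightarrow> state) \<Rightarrow> (int \<times> int) set \<Rightarrow> state set" where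
  "y_states S Q mesh = (\<Union>(i, j)\<in>updated_cells mesh.
    {y_minus S Q i j, y_plus S Q i j, y_minus S Q i (j - 1), y_plus S Q i (j - 1)})"

end

theory Submission
  imports Defs
begin

text \<open>
  The set of admissible states is an intersection of open half-spaces: the internal energy is
  positive iff \<open>E - m \<bullet> u + \<rho> |u|\<^sup>2 / 2 > 0\<close> for every vector \<open>u\<close>, the minimum being attained at
  \<open>u = m / \<rho>\<close>.  All convexity arguments thereby become linear.  Splitting each
  Lax--Friedrichs flux writes the updated average as a positive combination of the states
  \<open>\<alpha> U \<plusminus> G U\<close>, which are admissible when \<open>\<alpha>\<close> dominates the wave speed, plus the cell average
  minus multiples of its own limiting values.  The factor \<open>\<beta>\<close> of the limiter is
  exactly what keeps that last state in the closed cone of nonnegative internal energy.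
\<close>

section \<open>Half-space description of the admissible set\<close>

text \<open>This is the total energy density seen from a frame moving with velocity
  \<open>u\<close>; it is linear in the conservative variables.\<close>

definition energy_functional :: "real^3 \<Rightarrow> state \<Rightarrow> real" where
  "energy_functional u = (\<lambda>(\<rho>, m, E). E - m \<bullet> u + \<rho> / 2 * (norm u)\<^sup>2)"

text \<open>Non-strict inequalities appear because the limiter bound and the CFL condition may both
  hold with equality; the remainder state of the cell then has internal energy that is only
  nonnegative.\<close>

definition admissible_cone :: "state set" where
  "admissible_cone = {Q. fst Q \<ge> 0 \<and> (\<forall>u. energy_functional u Q \<ge> 0)}"

lemma energy_functional_add:
  "energy_functional u (Q + R) = energy_functional u Q + energy_functional u R"
  by (cases Q; cases R) (simp add: energy_functional_def algebra_simps inner_add_left add_divide_distrib)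

lemma energy_functional_scaleR: "energy_functional u (c *\<^sub>R Q) = c * energy_functional u Q"
  by (cases Q) (simp add: energy_functional_def algebra_simps)

lemma energy_functional_diff:
  "energy_functional u (Q - R) = energy_functional u Q - energy_functional u R"
  by (cases Q; cases R) (simp add: energy_functional_def algebra_simps inner_diff_left diff_divide_distrib)

lemma energy_functional_complete_square:
  assumes "\<rho> > 0"
  shows "energy_functional u (\<rho>, m, E)
    = E - (norm m)\<^sup>2 / (2 * \<rho>) + \<rho> / 2 * (norm (m /\<^sub>R \<rho> - u))\<^sup>2"
  using assms
  by (simp add: energy_functional_def power2_norm_eq_inner inner_diff_left inner_diff_right
      inner_commute) (simp add: field_simps)

lemma admissible_iff:
  "Q \<in> admissible \<longleftrightarrow> fst Q > 0 \<and> (\<forall>u. energy_functional u Q > 0)"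
proof (cases Q)
  case (fields \<rho> m E)
  have "E - (norm m)\<^sup>2 / (2 * \<rho>) > 0 \<longleftrightarrow> (\<forall>u. energy_functional u Q > 0)" if "\<rho> > 0"
  proof
    assume "E - (norm m)\<^sup>2 / (2 * \<rho>) > 0"
    then show "\<forall>u. energy_functional u Q > 0"
      using that by (auto simp: fields energy_functional_complete_square intro!: add_pos_nonneg)
  next
    assume "\<forall>u. energy_functional u Q > 0"
    then have "energy_functional (m /\<^sub>R \<rho>) Q > 0" ..
    then show "E - (norm m)\<^sup>2 / (2 * \<rho>) > 0"
      using that by (simp add: fields energy_functional_complete_square)
  qed
  then show ?thesis
    by (auto simp: admissible_def fields)
qed

lemma admissible_subset_cone: "admissible \<subseteq> admissible_cone"
  by (auto simp: admissible_iff admissible_cone_def less_imp_le)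

lemma admissible_cone_add:
  "\<lbrakk>Q \<in> admissible_cone; R \<in> admissible_cone\<rbrakk> \<Longrightarrow> Q + R \<in> admissible_cone"
  by (auto simp: admissible_cone_def energy_functional_add)

lemma admissible_cone_scaleR:
  "\<lbrakk>c \<ge> 0; Q \<in> admissible_cone\<rbrakk> \<Longrightarrow> c *\<^sub>R Q \<in> admissible_cone"
  by (auto simp: admissible_cone_def energy_functional_scaleR)

text \<open>One strict summand suffices: in the update the flux-splitting states supply strictness,
  the remainder of the cell average only nonnegativity.\<close>

lemma admissible_cone_add_admissible:
  "\<lbrakk>Q \<in> admissible_cone; R \<in> admissible\<rbrakk> \<Longrightarrow> Q + R \<in> admissible"
  by (auto simp: admissible_cone_def admissible_iff energy_functional_add intro: add_nonneg_pos)

lemma admissible_add: "\<lbrakk>Q \<in> admissible; R \<in> admissible\<rbrakk> \<Longrightarrow> Q + R \<in> admissible"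
  by (auto simp: admissible_iff energy_functional_add intro: add_pos_pos)

lemma admissible_scaleR: "\<lbrakk>c > 0; Q \<in> admissible\<rbrakk> \<Longrightarrow> c *\<^sub>R Q \<in> admissible"
  by (auto simp: admissible_iff energy_functional_scaleR)

section \<open>Primitive and conservative variables\<close>

text \<open>Internal energy plus kinetic energy relative to \<open>u\<close>. Velocity enters only
  through \<open>v - u\<close>, the variable of the quadratics below.\<close>

lemma energy_functional_cons:
  "energy_functional u (cons \<gamma> (\<rho>, v, p)) = p / (\<gamma> - 1) + \<rho> / 2 * (norm (v - u))\<^sup>2"
  by (simp add: energy_functional_def cons_def power2_norm_eq_inner inner_diff_left
      inner_diff_right inner_commute algebra_simps)

lemma cons_admissible:
  assumes "\<gamma> > 1" "\<rho> > 0" "p > 0"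
  shows "cons \<gamma> (\<rho>, v, p) \<in> admissible"
proof -
  have "energy_functional u (cons \<gamma> (\<rho>, v, p)) > 0" for u
    unfolding energy_functional_cons using assms by (intro add_pos_nonneg) auto
  then show ?thesis
    using assms by (simp add: admissible_iff) (simp add: cons_def)
qed

lemma admissible_primE:
  assumes "\<gamma> > 1" "Q \<in> admissible"
  obtains \<rho> v p where "prim \<gamma> Q = (\<rho>, v, p)" "Q = cons \<gamma> (\<rho>, v, p)" "\<rho> > 0" "p > 0"
proof -
  obtain \<rho> m E where Q: "Q = (\<rho>, m, E)" "\<rho> > 0" "E - (norm m)\<^sup>2 / (2 * \<rho>) > 0"
    using assms(2) by (auto simp: admissible_def)
  have "Q = cons \<gamma> (\<rho>, m /\<^sub>R \<rho>, (\<gamma> - 1) * (E - (norm m)\<^sup>2 / (2 * \<rho>)))"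
    using assms(1) Q(2)
    by (simp add: Q(1) cons_def power_divide field_simps power2_eq_square)
  with Q assms(1) show thesis
    by (intro that[of \<rho> "m /\<^sub>R \<rho>" "(\<gamma> - 1) * (E - (norm m)\<^sup>2 / (2 * \<rho>))"]) (auto simp: prim_def)
qed

section \<open>Lax--Friedrichs splitting\<close>

text \<open>The sound speed of an admissible state is strictly positive. This makes the weights of
  the limiter well defined and positive.\<close>

lemma speed_pos:
  assumes "\<gamma> > 1" "Q \<in> admissible" "wave_speed \<gamma> l Q \<le> \<alpha>"
  shows "\<alpha> > 0"
proof -
  obtain \<rho> v p where P: "prim \<gamma> Q = (\<rho>, v, p)" "\<rho> > 0" "p > 0"
    using admissible_primE[OF assms(1,2)] by metis
  then have "sqrt (\<gamma> * p / \<rho>) > 0" using assms(1) by simp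
  moreover have "\<bar>v $ l\<bar> + sqrt (\<gamma> * p / \<rho>) \<le> \<alpha>"
    using assms(3) P(1) by (simp add: wave_speed_def)
  ultimately show ?thesis by linarith
qed

text \<open>The functional of the split state is \<open>k\<close> times the energy in the moving
  frame plus the pressure work \<open>s * p * d\<close>, the only term that can be negative. As a
  quadratic in \<open>d\<close> it has negative discriminant, since \<open>k\<close> is at least the
  sound speed.\<close>

lemma flux_splitting_admissible:
  assumes "\<gamma> > 1" "Q \<in> admissible" "wave_speed \<gamma> l Q \<le> \<alpha>" "s = 1 \<or> s = -1"
  shows "\<alpha> *\<^sub>R Q + s *\<^sub>R flux \<gamma> l Q \<in> admissible"
proof -
  obtain \<rho> v p where P: "prim \<gamma> Q = (\<rho>, v, p)" "Q = cons \<gamma> (\<rho>, v, p)" "\<rho> > 0" "p > 0"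
    using admissible_primE[OF assms(1,2)] by metis
  define k where "k = \<alpha> + s * v $ l"
  have c_pos: "sqrt (\<gamma> * p / \<rho>) > 0" using P assms(1) by simp
  have c_le: "sqrt (\<gamma> * p / \<rho>) \<le> k"
    using assms(3,4) P(1) by (auto simp: wave_speed_def k_def)
  have k_pos: "k > 0" using c_pos c_le by linarith
  have "(sqrt (\<gamma> * p / \<rho>))\<^sup>2 \<le> k\<^sup>2" using c_le c_pos by (intro power_mono) auto
  then have k_sq: "\<gamma> * p \<le> \<rho> * k\<^sup>2" using P assms(1) by (simp add: field_simps)
  have "energy_functional u (\<alpha> *\<^sub>R Q + s *\<^sub>R flux \<gamma> l Q) > 0" for u
  proof -
    define d where "d = (v - u) $ l"
    have "energy_functional u (\<alpha> *\<^sub>R Q + s *\<^sub>R flux \<gamma> l Q)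
      = k * (p / (\<gamma> - 1) + \<rho> / 2 * (norm (v - u))\<^sup>2) + s * p * d"
      using P(1) unfolding P(2)
      by (simp add: flux_def energy_functional_def cons_def power2_norm_eq_inner inner_diff_left
          inner_diff_right inner_add_left inner_axis inner_axis' inner_commute k_def d_def algebra_simps
          add_divide_distrib)
    \<comment> \<open>The pressure term sees only the normal component \<open>d\<close>, so dropping
      the tangential part of \<open>v - u\<close> leaves a quadratic in one real variable.\<close>
    moreover have "\<dots> \<ge> k * (p / (\<gamma> - 1) + \<rho> / 2 * d\<^sup>2) + s * p * d"
    proof -
      have "\<bar>d\<bar> \<le> norm (v - u)" unfolding d_def by (rule component_le_norm_cart)
      then have "d\<^sup>2 \<le> (norm (v - u))\<^sup>2" by (metis abs_le_square_iff abs_norm_cancel)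
      then show ?thesis
        using k_pos P(3) by (intro add_right_mono mult_left_mono add_left_mono) auto
    qed
    moreover have "k * (p / (\<gamma> - 1) + \<rho> / 2 * d\<^sup>2) + s * p * d > 0"
    proof -
      have s_sq: "s\<^sup>2 = 1" using assms(4) by auto
      \<comment> \<open>The positive factor \<open>2 * \<rho> * k\<close> turns the quadratic into a
        square plus a constant. Keeping \<open>s\<^sup>2\<close> symbolic makes this one identity
        for both signs.\<close>
      have "2 * \<rho> * k * (k * (p / (\<gamma> - 1) + \<rho> / 2 * d\<^sup>2) + s * p * d)
        = (\<rho> * k * d + s * p)\<^sup>2 + p * (2 * (\<rho> * k\<^sup>2) / (\<gamma> - 1) - s\<^sup>2 * p)"
        by (simp add: algebra_simps power2_eq_square)
      also have "\<dots> > 0"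
      proof -
        have "p * (\<gamma> - 1) < 2 * (\<gamma> * p)"
        proof -
          have "2 * (\<gamma> * p) - p * (\<gamma> - 1) = p * (\<gamma> + 1)" by (simp add: algebra_simps)
          then show ?thesis using P(4) assms(1) by (smt (verit) mult_pos_pos)
        qed
        also have "\<dots> \<le> 2 * (\<rho> * k\<^sup>2)" using k_sq by simp
        finally have "p < 2 * (\<rho> * k\<^sup>2) / (\<gamma> - 1)" using assms(1) by (simp add: field_simps)
        then show ?thesis using P(4) unfolding s_sq by (intro add_nonneg_pos) auto
      qed
      finally show ?thesis by (rule zero_less_mult_pos) (use P(3) k_pos in simp)
    qed
    ultimately show ?thesis by linarith
  qed
  moreover have "fst (\<alpha> *\<^sub>R Q + s *\<^sub>R flux \<gamma> l Q) = \<rho> * k"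
    unfolding P(2) by (simp add: flux_def cons_def k_def algebra_simps split: prod.split)
  ultimately show ?thesis using P(3) k_pos by (simp add: admissible_iff)
qed

section \<open>Limited reconstruction in a cell\<close>

text \<open>Adding opposite limiting values cancels the pressure increments and leaves a quadratic
  in \<open>v - u\<close> with leading coefficient \<open>(q - 2) * \<rho> / 2\<close>. The
  assumption \<open>bound\<close> says precisely that its minimum is nonnegative.\<close>

lemma limiting_values_cone:
  fixes v ux uy :: "real^3"
  assumes "\<gamma> > 1" "q > 2" "\<rho> > 0" "Cx + Cy = 1"
    and bound: "2 * (norm ((Cx * a) *\<^sub>R ux + (Cy * b) *\<^sub>R uy))\<^sup>2
      + (q - 2) * \<rho>\<^sup>2 * (Cx * (norm ux)\<^sup>2 + Cy * (norm uy)\<^sup>2) \<le> (q - 2)\<^sup>2 * \<rho> * p / (\<gamma> - 1)"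
  shows "q *\<^sub>R cons \<gamma> (\<rho>, v, p)
    - Cx *\<^sub>R (cons \<gamma> (\<rho> + a, v + ux, p + c) + cons \<gamma> (\<rho> - a, v - ux, p - c))
    - Cy *\<^sub>R (cons \<gamma> (\<rho> + b, v + uy, p + d) + cons \<gamma> (\<rho> - b, v - uy, p - d))
    \<in> admissible_cone" (is "?B \<in> _")
proof -
  have Cy: "Cy = 1 - Cx" using assms(4) by simp
  define w where "w = (Cx * a) *\<^sub>R ux + (Cy * b) *\<^sub>R uy"
  define K where "K = Cx * (norm ux)\<^sup>2 + Cy * (norm uy)\<^sup>2"
  have "energy_functional u ?B \<ge> 0" for u
  proof -
    define z where "z = v - u"
    \<comment> \<open>Terms of odd order in the increments cancel; the product of density and
      velocity increments survives as \<open>2 * a * (x \<bullet> z)\<close>. The local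
      \<open>a x c\<close> are generic, to serve both directions.\<close>
    have pair: "energy_functional u (cons \<gamma> (\<rho> + a, v + x, p + c) + cons \<gamma> (\<rho> - a, v - x, p - c))
      = 2 * p / (\<gamma> - 1) + \<rho> * (norm z)\<^sup>2 + \<rho> * (norm x)\<^sup>2 + 2 * a * (x \<bullet> z)" for a x c
    proof -
      have "energy_functional u (cons \<gamma> (\<rho> + a, v + x, p + c) + cons \<gamma> (\<rho> - a, v - x, p - c))
        = (p + c) / (\<gamma> - 1) + (p - c) / (\<gamma> - 1)
          + (\<rho> + a) / 2 * (norm (z + x))\<^sup>2 + (\<rho> - a) / 2 * (norm (z - x))\<^sup>2"
        by (simp add: energy_functional_add energy_functional_cons z_def algebra_simps)
      also have "(p + c) / (\<gamma> - 1) + (p - c) / (\<gamma> - 1) = 2 * p / (\<gamma> - 1)"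
        by (simp add: add_divide_distrib[symmetric])
      also have "(\<rho> + a) / 2 * (norm (z + x))\<^sup>2 = (\<rho> + a) / 2 * (norm z)\<^sup>2
          + (\<rho> + a) / 2 * (norm x)\<^sup>2 + (\<rho> + a) * (x \<bullet> z)"
        by (simp add: power2_norm_eq_inner inner_add_left inner_add_right inner_commute
            distrib_left)
      also have "(\<rho> - a) / 2 * (norm (z - x))\<^sup>2 = (\<rho> - a) / 2 * (norm z)\<^sup>2
          + (\<rho> - a) / 2 * (norm x)\<^sup>2 - (\<rho> - a) * (x \<bullet> z)"
        by (simp add: power2_norm_eq_inner inner_diff_left inner_diff_right inner_commute
            right_diff_distrib distrib_left)
      finally show ?thesis by (simp add: ring_distribs add_divide_distrib diff_divide_distrib)
    qed
    have "energy_functional u ?B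
      = (q - 2) * (p / (\<gamma> - 1)) + (q - 2) * \<rho> / 2 * (norm z)\<^sup>2 - \<rho> * K - 2 * (w \<bullet> z)"
      by (simp only: energy_functional_diff energy_functional_scaleR pair)
        (simp add: energy_functional_cons z_def[symmetric] w_def K_def Cy inner_add_left
          algebra_simps add_divide_distrib diff_divide_distrib)
    \<comment> \<open>The square vanishes at the minimizer
      \<open>z = 2 w / ((q - 2) \<rho>)\<close>; what remains is the difference of the two sides of
      \<open>bound\<close>.\<close>
    moreover have "(q - 2) * \<rho> * \<dots> = (1 / 2) * (norm (((q - 2) * \<rho>) *\<^sub>R z - 2 *\<^sub>R w))\<^sup>2
      + ((q - 2)\<^sup>2 * \<rho> * p / (\<gamma> - 1) - (2 * (norm w)\<^sup>2 + (q - 2) * \<rho>\<^sup>2 * K))"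
      by (simp add: power2_norm_eq_inner inner_diff_left inner_diff_right inner_commute)
        (simp add: power2_eq_square algebra_simps add_divide_distrib diff_divide_distrib)
    moreover have "\<dots> \<ge> 0"
      using bound by (intro add_nonneg_nonneg) (auto simp: w_def K_def)
    ultimately have "0 \<le> (q - 2) * \<rho> * energy_functional u ?B" by metis
    then show ?thesis
      using mult_le_cancel_left_pos[of "(q - 2) * \<rho>" 0] assms(2,3) by simp
  qed
  moreover have "fst ?B = (q - 2) * \<rho>"
    by (simp add: cons_def Cy algebra_simps)
  ultimately show ?thesis
    using assms(2,3) by (simp add: admissible_cone_def)
qed

text \<open>The factor \<open>1 + e\<close> in the limiter is what makes the inequality
  strict.\<close>

lemma pos_factor_bound:
  assumes "e > 0" "w > 0"
  shows "\<bar>pos_factor e w d * d\<bar> < w"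
proof (cases "d = 0")
  case False
  have "\<bar>pos_factor e w d * d\<bar> = min (w / (\<bar>d\<bar> * (1 + e))) 1 * \<bar>d\<bar>"
    using assms False by (simp add: pos_factor_def abs_mult)
  also have "\<dots> \<le> w / (\<bar>d\<bar> * (1 + e)) * \<bar>d\<bar>" by (intro mult_right_mono) auto
  also have "\<dots> = w / (1 + e)" using False by simp
  also have "\<dots> < w" using assms by (simp add: field_simps)
  finally show ?thesis .
qed (use assms in simp)

text \<open>In primitive variables admissibility means positive density and pressure, which
  \<open>pos_factor\<close> preserves for either sign of the increment, whatever the value of
  \<beta>.\<close>

lemma limited_admissible:
  assumes "\<gamma> > 1" "e > 0" "Q \<in> admissible"
  shows "cons \<gamma> (prim \<gamma> Q + limited e \<beta> (prim \<gamma> Q) D) \<in> admissible"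
    and "cons \<gamma> (prim \<gamma> Q - limited e \<beta> (prim \<gamma> Q) D) \<in> admissible"
proof -
  obtain \<rho> v p where P: "prim \<gamma> Q = (\<rho>, v, p)" "\<rho> > 0" "p > 0"
    using admissible_primE[OF assms(1,3)] by metis
  obtain r u c where D: "D = (r, u, c)" by (cases D)
  show "cons \<gamma> (prim \<gamma> Q + limited e \<beta> (prim \<gamma> Q) D) \<in> admissible"
    "cons \<gamma> (prim \<gamma> Q - limited e \<beta> (prim \<gamma> Q) D) \<in> admissible"
    using pos_factor_bound[OF assms(2) P(2), of r] pos_factor_bound[OF assms(2) P(3), of c]
    by (auto simp: P(1) D limited_def intro!: cons_admissible assms(1))
qed

text \<open>The left side is homogeneous of degree two in the velocity increments, hence equals
  \<open>\<beta>\<^sup>2 * D\<close> with \<open>D\<close> the bracket in the denominator of the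
  limiter; the square root there is chosen to give the bound needed in
  \<open>limiting_values_cone\<close>.\<close>

lemma velocity_factor_bound:
  fixes vx vy :: "real^3"
  assumes "gam S > 1" "qlim S > 2" "\<rho> > 0" "p > 0" "weight_x S > 0" "weight_y S > 0"
    and \<beta>_def: "\<beta> = velocity_factor S (\<rho>, v, p) (\<rho>x, vx, px) (\<rho>y, vy, py)"
  shows "2 * (norm ((weight_x S * (pos_factor (eps S) \<rho> \<rho>x * \<rho>x)) *\<^sub>R (\<beta> *\<^sub>R vx)
        + (weight_y S * (pos_factor (eps S) \<rho> \<rho>y * \<rho>y)) *\<^sub>R (\<beta> *\<^sub>R vy)))\<^sup>2
      + (qlim S - 2) * \<rho>\<^sup>2 * (weight_x S * (norm (\<beta> *\<^sub>R vx))\<^sup>2 + weight_y S * (norm (\<beta> *\<^sub>R vy))\<^sup>2)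
    \<le> (qlim S - 2)\<^sup>2 * \<rho> * p / (gam S - 1)" (is "?L \<le> ?R")
proof (cases "norm vx + norm vy = 0")
  case True
  then have "vx = 0" "vy = 0" by (smt (verit) norm_ge_zero norm_eq_zero)+
  then show ?thesis using assms by simp
next
  case False
  define M where "M = (norm ((weight_x S * pos_factor (eps S) \<rho> \<rho>x * \<rho>x) *\<^sub>R vx
    + (weight_y S * pos_factor (eps S) \<rho> \<rho>y * \<rho>y) *\<^sub>R vy))\<^sup>2"
  define K where "K = weight_x S * (norm vx)\<^sup>2 + weight_y S * (norm vy)\<^sup>2"
  define D where "D = 2 * M + (qlim S - 2) * \<rho>\<^sup>2 * K"
  \<comment> \<open>With both weights positive, one nonzero velocity increment already forces
    \<open>D > 0\<close>, so division by \<open>D\<close> is legitimate.\<close>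
  have "vx \<noteq> 0 \<or> vy \<noteq> 0" using False by auto
  then have "K > 0"
    using assms(5,6) unfolding K_def by (auto intro: add_pos_nonneg add_nonneg_pos)
  then have D_pos: "D > 0"
    using assms unfolding D_def M_def by (intro add_nonneg_pos) auto
  have \<beta>: "\<beta> = min (sqrt ((qlim S - 2)\<^sup>2 * \<rho> * p / ((gam S - 1) * D))) 1"
    using False by (simp add: \<beta>_def velocity_factor_def Let_def D_def M_def K_def)
  have arg: "(qlim S - 2)\<^sup>2 * \<rho> * p / ((gam S - 1) * D) \<ge> 0"
    using assms D_pos by simp
  have "\<beta>\<^sup>2 \<le> (sqrt ((qlim S - 2)\<^sup>2 * \<rho> * p / ((gam S - 1) * D)))\<^sup>2"
    using arg unfolding \<beta> by (intro power_mono) auto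
  then have "\<beta>\<^sup>2 \<le> (qlim S - 2)\<^sup>2 * \<rho> * p / ((gam S - 1) * D)"
    using arg by simp
  then have "\<beta>\<^sup>2 * D \<le> (qlim S - 2)\<^sup>2 * \<rho> * p / ((gam S - 1) * D) * D"
    using D_pos by (intro mult_right_mono) auto
  moreover have "?L = \<beta>\<^sup>2 * D"
  proof -
    have "(weight_x S * (pos_factor (eps S) \<rho> \<rho>x * \<rho>x)) *\<^sub>R (\<beta> *\<^sub>R vx)
        + (weight_y S * (pos_factor (eps S) \<rho> \<rho>y * \<rho>y)) *\<^sub>R (\<beta> *\<^sub>R vy)
      = \<beta> *\<^sub>R ((weight_x S * pos_factor (eps S) \<rho> \<rho>x * \<rho>x) *\<^sub>R vx
    + (weight_y S * pos_factor (eps S) \<rho> \<rho>y * \<rho>y) *\<^sub>R vy)"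
      by (simp add: scaleR_add_right mult_ac)
    then show ?thesis
      unfolding D_def M_def K_def
      by (simp only: norm_scaleR power_mult_distrib power2_abs) (simp add: algebra_simps)
  qed
  ultimately show ?thesis using D_pos by simp
qed

section \<open>Decomposition of the update\<close>

text \<open>\<open>X1\<close>, \<open>X2\<close> are the traces of the updated cell,
  \<open>N1\<close>, \<open>N2\<close> those of its neighbours. Numerical viscosity already has the
  right sign on the neighbours' traces; on the cell's own traces it is reversed by adding and
  subtracting \<open>2 * h * \<alpha>\<close> times them.\<close>

lemma lf_flux_difference_split:
  "(2 * h) *\<^sub>R (lf_flux \<gamma> l \<alpha> X1 N1 - lf_flux \<gamma> l \<alpha> N2 X2)
    = (2 * h * \<alpha>) *\<^sub>R (X1 + X2)
      - h *\<^sub>R ((\<alpha> *\<^sub>R X1 + (-1) *\<^sub>R flux \<gamma> l X1) + (\<alpha> *\<^sub>R N1 + (-1) *\<^sub>R flux \<gamma> l N1)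
        + (\<alpha> *\<^sub>R X2 + 1 *\<^sub>R flux \<gamma> l X2) + (\<alpha> *\<^sub>R N2 + 1 *\<^sub>R flux \<gamma> l N2))"
proof -
  define a where "a = h * \<alpha>"
  have lf: "(2 * h) *\<^sub>R lf_flux \<gamma> l \<alpha> U V
    = h *\<^sub>R flux \<gamma> l U + h *\<^sub>R flux \<gamma> l V - a *\<^sub>R V + a *\<^sub>R U" for U V
    by (simp add: lf_flux_def a_def scaleR_diff_right scaleR_add_right)
  have "(2 * h * \<alpha>) *\<^sub>R U = a *\<^sub>R U + a *\<^sub>R U" for U :: state
    by (simp add: a_def scaleR_add_left[symmetric])
  then show ?thesis
    by (simp add: scaleR_diff_right scaleR_add_right lf a_def[symmetric])
qed

lemma flux_splitting_sum_admissible: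
  assumes "\<gamma> > 1" "h > 0"
    and "\<And>U. U \<in> {X1, N1, N2, X2} \<Longrightarrow> U \<in> admissible \<and> wave_speed \<gamma> l U \<le> \<alpha>"
  shows "h *\<^sub>R ((\<alpha> *\<^sub>R X1 + (-1) *\<^sub>R flux \<gamma> l X1) + (\<alpha> *\<^sub>R N1 + (-1) *\<^sub>R flux \<gamma> l N1)
        + (\<alpha> *\<^sub>R X2 + 1 *\<^sub>R flux \<gamma> l X2) + (\<alpha> *\<^sub>R N2 + 1 *\<^sub>R flux \<gamma> l N2)) \<in> admissible"
proof -
  have split: "\<alpha> *\<^sub>R U + s *\<^sub>R flux \<gamma> l U \<in> admissible"
    if "U \<in> {X1, N1, N2, X2}" "s = 1 \<or> s = -1" for U s
    using assms(3)[OF that(1)] that(2) by (simp add: flux_splitting_admissible[OF assms(1)])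
  show ?thesis
    by (intro admissible_scaleR[OF assms(2)] admissible_add[OF admissible_add[OF admissible_add]]
        split) simp_all
qed

theorem theorem3p10:
  fixes S :: scheme
    and Q :: "int \<Rightarrow> int \<Rightarrow> state"
    and mesh :: "(int \<times> int) set"
  assumes "gam S > 1" and "dx S > 0" and "dy S > 0" and "dt S > 0" and "eps S > 0"
    and "qlim S > 2"
    and "\<forall>U \<in> x_states S Q mesh. speed1 S \<ge> wave_speed (gam S) 1 U"
    and "\<forall>U \<in> y_states S Q mesh. speed2 S \<ge> wave_speed (gam S) 2 U"
    and "\<forall>(i, j) \<in> mesh. Q i j \<in> admissible"
    and "dt S * (speed1 S / dx S + speed2 S / dy S) \<le> 1 / qlim S"
  shows "\<forall>(i, j) \<in> updated_cells mesh.
    Q i j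
    - (dt S / dx S) *\<^sub>R
        (lf_flux (gam S) 1 (speed1 S) (x_minus S Q i j) (x_plus S Q i j)
         - lf_flux (gam S) 1 (speed1 S) (x_minus S Q (i - 1) j) (x_plus S Q (i - 1) j))
    - (dt S / dy S) *\<^sub>R
        (lf_flux (gam S) 2 (speed2 S) (y_minus S Q i j) (y_plus S Q i j)
         - lf_flux (gam S) 2 (speed2 S) (y_minus S Q i (j - 1)) (y_plus S Q i (j - 1)))
    \<in> admissible"
proof clarify
  fix i j assume upd: "(i, j) \<in> updated_cells mesh"
  have adm: "Q k l \<in> admissible" if "\<bar>k - i\<bar> + \<bar>l - j\<bar> \<le> 2" for k l
    using upd that assms(9) by (auto simp: updated_cells_def stencil_def)
  have x_adm: "U \<in> admissible \<and> wave_speed (gam S) 1 U \<le> speed1 S"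
    if "U \<in> {x_minus S Q i j, x_plus S Q i j, x_minus S Q (i - 1) j, x_plus S Q (i - 1) j}" for U
  proof
    show "U \<in> admissible"
      using that assms(1,5) by (auto simp: x_minus_def x_plus_def limited_x_def Let_def
          intro!: limited_admissible adm)
    show "wave_speed (gam S) 1 U \<le> speed1 S"
      using that upd assms(7) unfolding x_states_def by blast
  qed
  have y_adm: "U \<in> admissible \<and> wave_speed (gam S) 2 U \<le> speed2 S"
    if "U \<in> {y_minus S Q i j, y_plus S Q i j, y_minus S Q i (j - 1), y_plus S Q i (j - 1)}" for U
  proof
    show "U \<in> admissible"
      using that assms(1,5) by (auto simp: y_minus_def y_plus_def limited_y_def Let_def
          intro!: limited_admissible adm)
    show "wave_speed (gam S) 2 U \<le> speed2 S"
      using that upd assms(8) unfolding y_states_def by blast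
  qed
  have speeds: "speed1 S > 0" "speed2 S > 0"
    using x_adm[of "x_minus S Q i j"] y_adm[of "y_minus S Q i j"] speed_pos[OF assms(1)] by blast+
  define Cx Cy \<mu> where "Cx = weight_x S" and "Cy = weight_y S"
    and "\<mu> = dt S * (speed1 S / dx S + speed2 S / dy S)"
  have denom: "speed1 S * dy S + speed2 S * dx S > 0"
    using speeds assms(2,3) by (simp add: add_pos_pos)
  have C: "Cx > 0" "Cy > 0" "Cx + Cy = 1"
    using speeds assms(2,3) denom
    by (auto simp: Cx_def Cy_def weight_x_def weight_y_def add_divide_distrib[symmetric])
  have \<mu>: "\<mu> \<ge> 0" "\<mu> * qlim S \<le> 1"
    using speeds assms(2,3,4,6,10) by (auto simp: \<mu>_def field_simps)
  have \<mu>': "\<mu> = dt S * (speed1 S * dy S + speed2 S * dx S) / (dx S * dy S)"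
    using assms(2,3) by (simp add: \<mu>_def field_simps)
  \<comment> \<open>The weights are the shares of the two directions in the CFL number \<mu>, so the
    viscosity subtracted from the cell average is \<mu> times a convex combination.\<close>
  have \<mu>C: "dt S / dx S * speed1 S = \<mu> * Cx" "dt S / dy S * speed2 S = \<mu> * Cy"
    unfolding \<mu>' Cx_def Cy_def weight_x_def weight_y_def using denom assms(2,3) by simp_all
  define X Y where "X = x_minus S Q i j + x_plus S Q (i - 1) j"
    and "Y = y_minus S Q i j + y_plus S Q i (j - 1)"
  have Qij: "Q i j \<in> admissible" by (simp add: adm)
  obtain \<rho> v p where P: "prim (gam S) (Q i j) = (\<rho>, v, p)" "Q i j = cons (gam S) (\<rho>, v, p)"
    "\<rho> > 0" "p > 0"
    using admissible_primE[OF assms(1) Qij] by metis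
  obtain \<rho>x vx px where ix: "incr_x S Q i j = (\<rho>x, vx, px)" by (cases "incr_x S Q i j")
  obtain \<rho>y vy py where iy: "incr_y S Q i j = (\<rho>y, vy, py)" by (cases "incr_y S Q i j")
  define \<beta> where "\<beta> = velocity_factor S (\<rho>, v, p) (\<rho>x, vx, px) (\<rho>y, vy, py)"
  note \<beta>_bound = velocity_factor_bound[OF assms(1,6) P(3,4) C(1,2)[unfolded Cx_def Cy_def] \<beta>_def,
      folded Cx_def Cy_def]
  \<comment> \<open>The limiter bound determines the density and velocity increments by unification;
    \<open>v\<close> and the pressure increments do not occur in it and are supplied
    explicitly.\<close>
  have "qlim S *\<^sub>R Q i j - Cx *\<^sub>R X - Cy *\<^sub>R Y \<in> admissible_cone"
    using limiting_values_cone[OF assms(1,6) P(3) C(3) \<beta>_bound, where v = v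
        and c = "pos_factor (eps S) p px * px" and d = "pos_factor (eps S) p py * py"]
    unfolding P(2)[symmetric]
    by (simp add: X_def Y_def x_minus_def x_plus_def y_minus_def y_plus_def limited_x_def
        limited_y_def limited_def Let_def P(1) ix iy \<beta>_def)
  \<comment> \<open>The CFL condition enters here: a fraction \<open>\<mu> * qlim S\<close> of the
    cell average pays for its own traces, and the rest has a nonnegative coefficient.\<close>
  then have "(1 - \<mu> * qlim S) *\<^sub>R Q i j + \<mu> *\<^sub>R (qlim S *\<^sub>R Q i j - Cx *\<^sub>R X - Cy *\<^sub>R Y) \<in> admissible_cone"
    using \<mu> Qij admissible_subset_cone by (intro admissible_cone_add admissible_cone_scaleR) auto
  then have base: "Q i j - (\<mu> * Cx) *\<^sub>R X - (\<mu> * Cy) *\<^sub>R Y \<in> admissible_cone"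
    by (simp add: algebra_simps)
  define hx hy where "hx = dt S / dx S / 2" and "hy = dt S / dy S / 2"
  have h: "hx > 0" "hy > 0" "dt S / dx S = 2 * hx" "dt S / dy S = 2 * hy"
    using assms(2,3,4) by (simp_all add: hx_def hy_def)
  have rearrange: "A - (x - x') - (y - y') = (A - x - y) + (x' + y')" for A x x' y y' :: state
    by simp
  show "Q i j
    - (dt S / dx S) *\<^sub>R
        (lf_flux (gam S) 1 (speed1 S) (x_minus S Q i j) (x_plus S Q i j)
         - lf_flux (gam S) 1 (speed1 S) (x_minus S Q (i - 1) j) (x_plus S Q (i - 1) j))
    - (dt S / dy S) *\<^sub>R
        (lf_flux (gam S) 2 (speed2 S) (y_minus S Q i j) (y_plus S Q i j)
         - lf_flux (gam S) 2 (speed2 S) (y_minus S Q i (j - 1)) (y_plus S Q i (j - 1)))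
    \<in> admissible"
    \<comment> \<open>The update becomes the cone element \<open>base\<close> plus one strictly
      admissible sum of split states per direction.\<close>
    unfolding h(3,4) lf_flux_difference_split rearrange
    unfolding \<mu>C[unfolded h(3,4)] X_def[symmetric] Y_def[symmetric]
    by (rule admissible_cone_add_admissible[OF base admissible_add])
      (rule flux_splitting_sum_admissible[OF assms(1)], fact, erule x_adm y_adm)+
qed

end
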